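(* Let $(A_k)_{k \geq 1}$ be the sequence of positive real numbers, and $(\rho_k)_{k\ge 1}$ and $\psi$ the arithmetic functions, described in the context. Then $$A_k = \frac{6}{\pi^2}\sum_{n=1}^\infty \frac{\rho_k(n)}{\psi(n)}$$ for each positive integer $k$.
   Context: For a natural number $n > 1$ with prime factorization $n = p_1^{a_1}\cdots p_s^{a_s}$ ($p_1 < \cdots < p_s$ primes, $a_1,\dots,a_s$ positive integers), $f(n) := \#\{a_1,\dots,a_s\}$ is the number of distinct exponents; also $f(1) := 0$. $(A_k)_{k \geq 1}$ is the (unique) sequence of positive real numbers with the following property: for every real $a>1$ and every arithmetic function $\phi$ (complex-valued function on the positive integers, with the convention $\phi(0):=0$) satisfying $|\phi(k)| < a^k$ for all $k\ge 1$, the series $M_\phi := \sum_{k=1}^\infty A_k\phi(k)$ converges and $\sum_{n \leq x}\phi(f(n)) = M_\phi x + O_{a,\varepsilon}(x^{1/2+\varepsilon})$ for all $x \geq 1$ and $\varepsilon > 0$. (The existence of such a sequence is a separate theorem of the paper.) In particular, for each $k\ge 1$, $\#\{n \leq x : f(n) = k\} = A_k x + O_\varepsilon(x^{1/2+\varepsilon})$, so $A_k$ is the natural density of $\{n : f(n)=k\}$. The Dedekind function is $\psi(n) := n\prod_{p \mid n}\left(1 + \frac1p\right)$ for each positive integer $n$, the product being over primes $p$ dividing $n$. $(\rho_k)_{k\ge1}$ is the family of arithmetic functions supported on squarefree numbers (i.e. $\rho_k(n) = 0$ if $n$ is not squarefree) such that, for all squarefree $n$ and all positive integers $k$: $\rho_1(1)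 = 1$ and $\rho_1(n) = 0$ if $n>1$; $\rho_{k+1}(1) = 0$ and $\rho_{k+1}(n) = \frac{1}{n-1}\sum_{d \mid n,\ d < n}\rho_k(d)$ if $n > 1$. *)

theory Defs
  imports Complex_Main "HOL-Computational_Algebra.Computational_Algebra"
begin

definition num_exponents :: "nat \<Rightarrow> nat" where
  "num_exponents n = card ((\<lambda>p. multiplicity p n) ` prime_factors n)"

text \<open>
  The characteristic property of the sequence \<open>(A k)\<close>, \<open>k \<ge> 1\<close>; the value \<open>A 0\<close> plays no role.
  The implied constant \<open>C\<close> is chosen before \<open>\<phi>\<close> and \<open>x\<close>, so it depends only on \<open>a\<close> and \<open>\<epsilon>\<close>
  (and on the fixed sequence).
\<close>
definition exponent_densities :: "(nat \<Rightarrow> real) \<Rightarrow> bool" where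
  "exponent_densities A \<longleftrightarrow>
     (\<forall>k\<ge>1. A k > 0) \<and>
     (\<forall>a::real. a > 1 \<longrightarrow>
        (\<forall>\<phi>::nat \<Rightarrow> complex. \<phi> 0 = 0 \<and> (\<forall>k\<ge>1. norm (\<phi> k) < a ^ k) \<longrightarrow>
           summable (\<lambda>k. of_real (A (Suc k)) * \<phi> (Suc k))) \<and>
        (\<forall>\<epsilon>>0. \<exists>C::real. \<forall>\<phi>::nat \<Rightarrow> complex.
           \<phi> 0 = 0 \<and> (\<forall>k\<ge>1. norm (\<phi> k) < a ^ k) \<longrightarrow>
           (\<forall>x::real. x \<ge> 1 \<longrightarrow>
              norm ((\<Sum>n | 1 \<le> n \<and> real n \<le> x. \<phi> (num_exponents n)) -
                    (\<Sum>k. of_real (A (Suc k)) * \<phi> (Suc k)) * of_real x)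
                \<le> C * x powr (1 / 2 + \<epsilon>))))"

definition dedekind_psi :: "nat \<Rightarrow> real" where
  "dedekind_psi n = real n * (\<Prod>p\<in>prime_factors n. 1 + 1 / real p)"

text \<open>
  The family is indexed from \<open>1\<close>; \<open>rho 0\<close> is a dummy value. Note that \<open>squarefree 0\<close> is false.
\<close>
fun rho :: "nat \<Rightarrow> nat \<Rightarrow> real" where
  "rho 0 n = 0"
| "rho (Suc 0) n = (if n = 1 then 1 else 0)"
| "rho (Suc (Suc k)) n =
     (if squarefree n \<and> n > 1
      then 1 / (real n - 1) * (\<Sum>d | d dvd n \<and> d < n. rho (Suc k) d)
      else 0)"

end

theory Submission
  imports Defs "HOL-Analysis.Analysis"
begin

text \<open>
  Why the formula holds. Put \<open>rad n\<close> for the product of the primes dividing \<open>n\<close>, and \<open>f\<close> for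
  \<open>num_exponents\<close>. Every \<open>n \<ge> 1\<close> is uniquely \<open>Q * m\<close> with \<open>m\<close> squarefree and divisible by \<open>rad Q\<close>
  (take \<open>m = rad n\<close>), and passing from \<open>Q\<close> to \<open>Q * m\<close> raises all exponents by one. Hence
  \<open>f n = f Q + 1\<close>, except that \<open>f n = f Q\<close> if \<open>m = rad Q\<close> (lemma \<open>num_exponents_mult\<close>). In the exceptional
  case \<open>n\<close> is powerful, and powerful numbers are too sparse to influence a density. So \<open>A k\<close> is the
  sum, over the \<open>Q\<close> with \<open>f Q = k - 1\<close>, of the densities of the sets of all \<open>Q * m\<close>, and such a set has
  density \<open>6 / \<pi>\<^sup>2 / (Q * \<Prod>p\<in>prime_factors Q. 1 + p)\<close>.

  Grouping the \<open>Q\<close> by \<open>n = rad Q\<close>, the product becomes \<open>dedekind_psi n\<close>, and there remains the sum of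
  \<open>1 / Q\<close> over all \<open>Q\<close> with \<open>rad Q = n\<close> and \<open>f Q = k - 1\<close>. This sum is \<open>rho k n\<close> (lemma
  \<open>has_sum_rho\<close>): dividing \<open>Q\<close> by its radical, again by \<open>num_exponents_mult\<close>, yields a linear
  equation for the sum that is the recurrence of \<open>rho\<close>.

  The densities are computed with Dirichlet series at real \<open>s > 1\<close>. The series of the squarefree
  numbers is \<open>\<zeta>(s) / \<zeta>(2s)\<close>, and restricting it to the multiples of \<open>rad Q\<close> divides it by
  \<open>\<Prod>p\<in>prime_factors Q. 1 + p powr s\<close> (lemma \<open>has_sum_squarefree_multiples\<close>). Hence the series of all \<open>n\<close> with
  \<open>f n = k\<close> is \<open>\<zeta>(s) / \<zeta>(2s)\<close> times a sum over \<open>Q\<close> that converges at \<open>s = 1\<close>, up to a bounded error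
  (lemma \<open>exponent_count_series_approx\<close>). By partial summation it is also \<open>A k * \<zeta>(s)\<close> up to a
  bounded error (lemma \<open>exponent_densities_series_bound\<close>). Dividing by \<open>\<zeta>(s)\<close> and letting \<open>s\<close>
  decrease to 1, where \<open>\<zeta>(s)\<close> tends to infinity and \<open>\<zeta>(2s)\<close> to \<open>\<pi>\<^sup>2 / 6\<close>, identifies \<open>A k\<close>.
\<close>

section \<open>Radicals and numbers of distinct exponents\<close>

definition rad :: "nat \<Rightarrow> nat" where
  "rad n = \<Prod>(prime_factors n)"

lemma rad_pos [simp]: "rad n > 0"
  unfolding rad_def by (intro prod_pos) (auto intro: prime_gt_0_nat)

lemma prime_factors_rad [simp]: "prime_factors (rad n) = prime_factors n"
proof -
  have "prime_factors (\<Prod>p\<in>prime_factors n. p) = (\<Union>p\<in>prime_factors n. prime_factors p)"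
    by (subst prime_factors_prod) auto
  also have "\<dots> = prime_factors n"
    by (auto simp: prime_factorization_prime in_prime_factors_imp_prime)
  finally show ?thesis by (simp add: rad_def)
qed

lemma multiplicity_rad:
  assumes "p \<in> prime_factors n"
  shows "multiplicity p (rad n) = 1"
  using multiplicity_prod_prime_powers[of "prime_factors n" p "\<lambda>_. 1"] assms
  by (auto simp: rad_def)

lemma squarefree_rad [simp]: "squarefree (rad n)"
  by (subst squarefree_factorial_semiring') (auto simp: multiplicity_rad)

lemma rad_squarefree: "squarefree n \<Longrightarrow> rad n = n"
proof -
  assume n: "squarefree n"
  hence n0: "n \<noteq> 0" by (intro notI) simp
  have "n = (\<Prod>p\<in>prime_factors n. p ^ multiplicity p n)"
    using n0 by (simp add: prime_factorization_nat)
  also have "\<dots> = (\<Prod>p\<in>prime_factors n. p)"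
    using n n0 by (intro prod.cong) (auto simp: squarefree_factorial_semiring')
  finally show ?thesis by (simp add: rad_def)
qed

lemma rad_dvd_iff:
  assumes "m > 0"
  shows "rad n dvd m \<longleftrightarrow> prime_factors n \<subseteq> prime_factors m"
proof
  assume "rad n dvd m"
  thus "prime_factors n \<subseteq> prime_factors m"
    using dvd_prime_factors[of m "rad n"] assms by simp
next
  assume sub: "prime_factors n \<subseteq> prime_factors m"
  show "rad n dvd m"
  proof (rule multiplicity_le_imp_dvd)
    fix p :: nat assume p: "prime p"
    show "multiplicity p (rad n) \<le> multiplicity p m"
    proof (cases "p \<in> prime_factors n")
      case True
      thus ?thesis
        using sub by (auto simp: multiplicity_rad prime_factors_multiplicity Suc_le_eq)
    next
      case False
      hence "p \<notin> prime_factors (rad n)" by simp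
      hence "\<not> p dvd rad n"
        using p by (auto simp: in_prime_factors_iff simp del: prime_factors_rad)
      hence "multiplicity p (rad n) = 0" by (rule not_dvd_imp_multiplicity_0)
      thus ?thesis by simp
    qed
  qed simp
qed

lemma rad_dvd: "n > 0 \<Longrightarrow> rad n dvd n"
  by (simp add: rad_dvd_iff)

text \<open>
  Every positive \<open>n\<close> is uniquely \<open>Q * m\<close> with \<open>m\<close> squarefree and \<open>rad Q dvd m\<close>, namely with
  \<open>m = rad n\<close> and \<open>Q = n div rad n\<close>; this lemma and the next one give the two directions.
\<close>
lemma rad_mult:
  assumes "Q > 0" "squarefree m" "rad Q dvd m"
  shows "rad (Q * m) = m"
proof -
  have m0: "m > 0" using assms(2) by (intro Nat.gr0I) auto
  have "prime_factors (Q * m) = prime_factors m"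
    using assms m0 by (auto simp: prime_factors_product rad_dvd_iff)
  hence "rad (Q * m) = rad m" by (simp add: rad_def)
  thus ?thesis using assms by (simp add: rad_squarefree)
qed

lemma rad_div_rad_dvd: 
  assumes "n > 0"
  shows "rad (n div rad n) dvd rad n"
proof -
  have "n div rad n dvd n" using rad_dvd[OF assms] by (metis dvd_div_mult_self dvd_triv_left)
  thus ?thesis
    using assms by (simp add: rad_dvd_iff dvd_prime_factors)
qed

lemma squarefree_dvd_iff_dvd_rad:
  assumes "n > 0" "squarefree d"
  shows "d dvd rad n \<longleftrightarrow> d dvd n"
proof
  assume "d dvd n"
  hence "prime_factors d \<subseteq> prime_factors (rad n)"
    using assms dvd_prime_factors[of n d] by simp
  hence "rad d dvd rad n" by (subst rad_dvd_iff) auto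
  thus "d dvd rad n" using assms by (simp add: rad_squarefree)
qed (use rad_dvd[OF assms(1)] dvd_trans in blast)

text \<open>
  Multiplying by \<open>m\<close> raises every exponent on the primes of \<open>m\<close> by one. The primes of \<open>Q\<close> keep
  their number of distinct exponents, and a prime of \<open>m\<close> outside \<open>Q\<close>, if there is one, contributes
  the exponent 1, which no prime of \<open>Q\<close> has any longer.
\<close>
lemma num_exponents_mult:
  assumes "Q > 0" "squarefree m" "rad Q dvd m"
  shows "num_exponents (Q * m) = num_exponents Q + (if rad Q = m then 0 else 1)"
proof -
  have m0: "m > 0" using assms(2) by (intro Nat.gr0I) auto
  have sub: "prime_factors Q \<subseteq> prime_factors m"
    using assms m0 by (simp add: rad_dvd_iff)
  define g where "g = (\<lambda>p. multiplicity p Q)"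
  have pf: "prime_factors (Q * m) = prime_factors m"
    using assms m0 sub by (auto simp: prime_factors_product)
  have "(\<lambda>p. multiplicity p (Q * m)) ` prime_factors m = Suc ` g ` prime_factors m"
    unfolding image_image
  proof (rule image_cong)
    fix p assume p: "p \<in> prime_factors m"
    have "multiplicity p m = 1"
      using assms(2) m0 p by (auto simp: squarefree_factorial_semiring')
    thus "multiplicity p (Q * m) = Suc (g p)"
      using assms(1) m0 p
      by (subst prime_elem_multiplicity_mult_distrib) (auto simp: g_def)
  qed auto
  hence "num_exponents (Q * m) = card (g ` prime_factors m)"
    by (simp add: num_exponents_def pf card_image)
  also have "prime_factors m = prime_factors Q \<union> (prime_factors m - prime_factors Q)"
    using sub by auto
  also have "g ` \<dots> = g ` prime_factors Q \<union> g ` (prime_factors m - prime_factors Q)"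
    by (rule image_Un)
  also have "g ` (prime_factors m - prime_factors Q) = (if rad Q = m then {} else {0})"
  proof (cases "rad Q = m")
    case True
    thus ?thesis by auto
  next
    case False
    have "prime_factors Q \<noteq> prime_factors m"
    proof
      assume "prime_factors Q = prime_factors m"
      hence "rad Q = rad m" by (simp add: rad_def)
      thus False using False assms(2) by (simp add: rad_squarefree)
    qed
    with sub obtain q where q: "q \<in> prime_factors m - prime_factors Q" by auto
    have "g p = 0" if "p \<in> prime_factors m - prime_factors Q" for p
      using that assms(1)
      by (auto simp: g_def prime_factors_multiplicity)
    hence "g ` (prime_factors m - prime_factors Q) = {0}"
      using q by (intro equalityI subsetI) (auto simp: image_iff)
    thus ?thesis using False by simp
  qed
  also have "card (g ` prime_factors Q \<union> (if rad Q = m then {} else {0})) =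
               card (g ` prime_factors Q) + (if rad Q = m then 0 else 1)"
  proof -
    have "0 \<notin> g ` prime_factors Q"
      by (auto simp: g_def prime_factors_multiplicity)
    thus ?thesis by (auto simp: card_insert_if)
  qed
  finally show ?thesis by (simp add: num_exponents_def g_def)
qed

lemma num_exponents_eq_0_iff:
  assumes "n > 0"
  shows "num_exponents n = 0 \<longleftrightarrow> n = 1"
  using assms by (auto simp: num_exponents_def prime_factorization_empty_iff)

section \<open>The functions \<open>rho\<close> as sums over integers with given radical\<close>

text \<open>
  Write \<open>Q = r * d\<^sup>2\<close> with \<open>r\<close> squarefree. Then \<open>r\<close> divides \<open>rad Q\<close>, so that
  \<open>Q * rad Q \<ge> r\<^sup>2 * d\<^sup>2\<close>, and the double series over \<open>r\<close> and \<open>d\<close> converges. This one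
  majorant serves every limit and rearrangement below.
\<close>
lemma summable_on_inverse_mult_rad:
  "(\<lambda>Q. 1 / (real Q * real (rad Q))) summable_on {0<..}"
proof -
  let ?g = "\<lambda>n::nat. 1 / (real n)\<^sup>2"
  have g: "?g summable_on UNIV"
    using inverse_power_summable[of 2, where ?'a = real]
    by (intro summable_nonneg_imp_summable_on) (auto simp: field_simps)
  have "(\<lambda>(r, d). ?g r * ?g d) summable_on (UNIV \<times> UNIV)"
  proof (rule summable_on_SigmaI)
    show "((\<lambda>d. case (r, d) of (r, d) \<Rightarrow> ?g r * ?g d) has_sum ?g r * infsum ?g UNIV) UNIV" for r
      using has_sum_cmult_right[OF has_sum_infsum[OF g], of "?g r"] by simp
    show "(\<lambda>r. ?g r * infsum ?g UNIV) summable_on UNIV"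
      by (rule summable_on_cmult_left[OF g])
  qed auto
  hence "(\<lambda>(r, d). ?g r * ?g d) summable_on
           ((\<lambda>Q. (squarefree_part Q, square_part Q)) ` {0<..})"
    by (rule summable_on_subset) auto
  moreover have "inj_on (\<lambda>Q::nat. (squarefree_part Q, square_part Q)) {0<..}"
    by (rule inj_onI) (metis squarefree_decompose prod.inject)
  ultimately have "(\<lambda>Q. ?g (squarefree_part Q) * ?g (square_part Q)) summable_on {0<..}"
    by (subst (asm) summable_on_reindex) (auto simp: o_def)
  thus ?thesis
  proof (rule summable_on_comparison_test)
    fix Q :: nat assume "Q \<in> {0<..}"
    hence Q: "Q > 0" by simp
    define r d where "r = squarefree_part Q" and "d = square_part Q"
    have Qrd: "Q = r * d ^ 2" unfolding r_def d_def by (rule squarefree_decompose)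
    have "r \<noteq> 0" "d \<noteq> 0" using Q by (simp_all add: r_def d_def)
    hence rd: "r > 0" "d > 0" by simp_all
    have "r dvd rad Q"
      using Q by (subst squarefree_dvd_iff_dvd_rad, simp, simp add: r_def) (metis Qrd dvd_triv_left)
    hence "r \<le> rad Q" by (rule dvd_imp_le) simp
    moreover have "real Q = real r * real d ^ 2"
      by (subst Qrd) simp
    ultimately have "real r * real d ^ 2 * real r \<le> real Q * real (rad Q)"
      by (simp add: mult_left_mono)
    hence "1 / (real Q * real (rad Q)) \<le> 1 / (real r * real d ^ 2 * real r)"
      using rd by (intro divide_left_mono) (auto simp: Q)
    also have "\<dots> = ?g r * ?g d" by (simp add: power2_eq_square)
    finally show "1 / (real Q * real (rad Q)) \<le> ?g (squarefree_part Q) * ?g (square_part Q)"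
      by (simp add: r_def d_def)
  qed auto
qed

text \<open>
  Let \<open>n > 1\<close>. Removing one factor \<open>n\<close> from an integer with radical \<open>n\<close> and \<open>k + 1\<close>
  distinct exponents leaves either another such integer, or an integer with \<open>k\<close> distinct exponents
  whose radical is a proper divisor of \<open>n\<close>. The sum \<open>S\<close> over the former therefore satisfies
  \<open>S = (S + (\<Sum>d\<in>D. rho (Suc k) d)) / n\<close>, where \<open>D\<close> is the set of proper divisors, and solving
  this equation for \<open>S\<close> gives the recurrence that defines \<open>rho\<close>.
\<close>
lemma has_sum_rho:
  assumes "squarefree n"
  shows "((\<lambda>Q. 1 / real Q) has_sum rho (Suc k) n) {Q. Q > 0 \<and> rad Q = n \<and> num_exponents Q = k}"
  using assms
proof (induction k arbitrary: n)
  case 0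
  have "{Q. Q > 0 \<and> rad Q = n \<and> num_exponents Q = 0} = (if n = 1 then {1} else {})"
  proof -
    have "Q > 0 \<and> rad Q = n \<and> num_exponents Q = 0 \<longleftrightarrow> Q = 1 \<and> n = 1" for Q
      using num_exponents_eq_0_iff[of Q] rad_squarefree[of 1] by auto
    thus ?thesis by auto
  qed
  thus ?case by (simp only: ) (simp add: has_sum_finite_iff)
next
  case (Suc k)
  have n0: "n > 0" using Suc.prems by (intro Nat.gr0I) auto
  let ?X = "\<lambda>n k. {Q. Q > 0 \<and> rad Q = n \<and> num_exponents Q = k}"
  show ?case
  proof (cases "n = 1")
    case True
    have "Q \<notin> ?X n (Suc k)" for Q
    proof
      assume Q: "Q \<in> ?X n (Suc k)"
      have "prime_factors Q = prime_factors (rad Q)" by simp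
      also have "rad Q = 1" using Q True by simp
      finally have "num_exponents Q = 0" by (simp add: num_exponents_def)
      thus False using Q by simp
    qed
    hence "?X n (Suc k) = {}" by blast
    thus ?thesis using True by (simp only:) simp
  next
    case False
    with n0 have n1: "n > 1" by simp
    define D where "D = {d. d dvd n \<and> d < n}"
    have finD: "finite D" by (simp add: D_def)
    \<comment> \<open>The equation can be solved for the sum because the sum converges.\<close>
    have sumX: "(\<lambda>Q. 1 / real Q) summable_on ?X n (Suc k)"
    proof -
      have "(\<lambda>Q. 1 / (real Q * real (rad Q))) summable_on ?X n (Suc k)"
        by (rule summable_on_subset[OF summable_on_inverse_mult_rad]) auto
      hence "(\<lambda>Q. 1 / (real Q * real (rad Q)) * real n) summable_on ?X n (Suc k)"
        by (rule summable_on_cmult_left)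
      also have "?this \<longleftrightarrow> ?thesis"
        using n0 by (intro summable_on_cong) auto
      finally show ?thesis .
    qed
    define S where "S = infsum (\<lambda>Q. 1 / real Q) (?X n (Suc k))"
    have S: "((\<lambda>Q. 1 / real Q) has_sum S) (?X n (Suc k))"
      unfolding S_def using sumX by simp
    have IH: "((\<lambda>Q. 1 / real Q) has_sum rho (Suc k) d) (?X d k)" if "d \<in> D" for d
      using that Suc.prems by (intro Suc.IH) (auto simp: D_def intro: squarefree_mono)
    have "((\<lambda>Q. 1 / real Q) has_sum (\<Sum>d\<in>D. rho (Suc k) d)) (\<Union>d\<in>D. ?X d k)"
      by (rule sum_has_sum) (use IH finD in auto)
    with S have "((\<lambda>Q. 1 / real Q) has_sum (S + (\<Sum>d\<in>D. rho (Suc k) d)))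
              (?X n (Suc k) \<union> (\<Union>d\<in>D. ?X d k))"
      by (rule has_sum_Un_disjoint) (auto simp: D_def)
    hence "((\<lambda>Q. 1 / real Q * (1 / real n)) has_sum (S + (\<Sum>d\<in>D. rho (Suc k) d)) * (1 / real n))
              (?X n (Suc k) \<union> (\<Union>d\<in>D. ?X d k))"
      by (rule has_sum_cmult_left)
    also have "?this \<longleftrightarrow> ((\<lambda>Q. 1 / real Q) has_sum
                 (S + (\<Sum>d\<in>D. rho (Suc k) d)) * (1 / real n)) (?X n (Suc k))"
    proof (rule has_sum_reindex_bij_witness[of _ "\<lambda>Q. Q div n" "\<lambda>Q. Q * n"])
      fix Q assume Q: "Q \<in> ?X n (Suc k) \<union> (\<Union>d\<in>D. ?X d k)"
      hence "Q > 0" "rad Q dvd n" by (auto simp: D_def)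
      thus "Q * n \<in> ?X n (Suc k)"
        using Q n0 Suc.prems
        by (auto simp: rad_mult num_exponents_mult D_def)
    next
      fix Q assume Q: "Q \<in> ?X n (Suc k)"
      hence Q0: "Q > 0" "rad Q = n" "num_exponents Q = Suc k" by auto
      have dv: "n dvd Q" using rad_dvd[of Q] Q0 by simp
      define Q' where "Q' = Q div n"
      have QQ: "Q = Q' * n" using dv by (simp add: Q'_def)
      have Q'0: "Q' > 0" using QQ Q0 by (auto intro!: Nat.gr0I)
      have "rad Q' dvd n" using rad_div_rad_dvd[of Q] Q0 by (simp add: Q'_def)
      hence *: "num_exponents Q' + (if rad Q' = n then 0 else 1) = Suc k"
        using num_exponents_mult[of Q' n] Q'0 Suc.prems Q0 QQ by simp
      have "rad Q' \<le> n" using \<open>rad Q' dvd n\<close> n0 by (rule dvd_imp_le)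
      with * \<open>rad Q' dvd n\<close> show "Q div n \<in> ?X n (Suc k) \<union> (\<Union>d\<in>D. ?X d k)"
        using Q'0 by (auto simp: D_def Q'_def split: if_splits)
      show "Q div n * n = Q" using dv by simp
    qed (use n0 in auto)
    finally have "(S + (\<Sum>d\<in>D. rho (Suc k) d)) * (1 / real n) = S"
      using S has_sum_unique by blast
    hence "S = 1 / (real n - 1) * (\<Sum>d\<in>D. rho (Suc k) d)"
      using n1 by (simp add: field_simps)
    hence "S = rho (Suc (Suc k)) n"
      using n1 Suc.prems by (simp add: D_def)
    thus ?thesis using S by simp
  qed
qed

section \<open>Dirichlet series of squarefree numbers\<close>

lemma summable_on_powr:
  assumes "s > 1"
  shows "(\<lambda>n. real n powr - s) summable_on A"
proof -
  have "(\<lambda>n. real n powr - s) summable_on UNIV"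
    using assms by (intro summable_nonneg_imp_summable_on) (auto simp: summable_real_powr_iff)
  thus ?thesis by (rule summable_on_subset) auto
qed

definition zeta_sum :: "real \<Rightarrow> real" where
  "zeta_sum s = (\<Sum>\<^sub>\<infinity>n\<in>{0<..}. real n powr - s)"

definition squarefree_sum :: "real \<Rightarrow> real" where
  "squarefree_sum s = (\<Sum>\<^sub>\<infinity>m | squarefree m. real m powr - s)"

text \<open>
  Induction on \<open>T\<close>: multiplication by a new prime \<open>p\<close> maps the members of the index set that are
  prime to \<open>p\<close> bijectively to the multiples of \<open>p\<close> in it. If \<open>x\<close> is the sum over the multiples,
  the sum over all members is thus \<open>x + x * p powr s\<close>.
\<close>
lemma has_sum_squarefree_multiples:
  assumes s: "s > 1" and T: "finite T" "\<And>p. p \<in> T \<Longrightarrow> prime p"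
  shows "((\<lambda>m. real m powr - s) has_sum squarefree_sum s / (\<Prod>p\<in>T. 1 + real p powr s))
           {m. squarefree m \<and> (\<forall>p\<in>T. p dvd m)}"
  using T
proof (induction T rule: finite_induct)
  case empty
  show ?case using summable_on_powr[OF s] by (simp add: squarefree_sum_def)
next
  case (insert p T)
  let ?f = "\<lambda>m. real m powr - s"
  define S where "S = {m. squarefree m \<and> (\<forall>q\<in>T. q dvd m)}"
  define S1 where "S1 = {m \<in> S. p dvd m}"
  define S0 where "S0 = {m \<in> S. \<not> p dvd m}"
  define x where "x = infsum ?f S1"
  have p: "prime p" "p > 0" using insert.prems prime_gt_0_nat by auto
  have IH: "(?f has_sum squarefree_sum s / (\<Prod>p\<in>T. 1 + real p powr s)) S"
    unfolding S_def by (rule insert.IH) (use insert.prems in auto)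
  have S1: "(?f has_sum x) S1"
    unfolding x_def using summable_on_powr[OF s] by simp
  have "((\<lambda>m. ?f m * real p powr s) has_sum x * real p powr s) S1"
    by (rule has_sum_cmult_left[OF S1])
  also have "?this \<longleftrightarrow> (?f has_sum x * real p powr s) S0"
  proof (rule has_sum_reindex_bij_witness[of _ "\<lambda>m. m * p" "\<lambda>m. m div p"])
    fix m assume m: "m \<in> S1"
    then obtain r where r: "m = r * p" by (metis (no_types, lifting) S1_def dvdE mem_Collect_eq mult.commute)
    have sq: "squarefree m" using m by (simp add: S1_def S_def)
    have "\<not> p dvd r"
    proof
      assume "p dvd r"
      hence "p ^ 2 dvd m" unfolding r power2_eq_square by auto
      from squarefreeD[OF sq this] show False using p by auto
    qed
    moreover have "q dvd r" if q: "q \<in> T" for q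
    proof -
      have "q dvd r * p" using m q r by (auto simp: S1_def S_def)
      moreover have "\<not> q dvd p"
        using primes_dvd_imp_eq[of q p] p q insert by auto
      ultimately show ?thesis
        using insert.prems q prime_dvd_mult_iff[of q r p] by auto
    qed
    moreover have "squarefree r"
      using sq unfolding r by (rule squarefree_mono[rotated]) auto
    ultimately show "m div p \<in> S0" using r p by (auto simp: S0_def S_def)
    show "m div p * p = m" using r p by simp
    show "?f (m div p) = ?f m * real p powr s"
      using r p by (simp add: powr_mult powr_minus)
  next
    fix m assume m: "m \<in> S0"
    hence "coprime m p"
      using p prime_imp_coprime[of p m] by (auto simp: S0_def coprime_commute)
    hence "squarefree (m * p)"
      using m p squarefree_prime[of p] by (intro squarefree_mult_coprime) (auto simp: S0_def S_def)
    thus "m * p \<in> S1" using m by (auto simp: S1_def S0_def S_def)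
    show "m * p div p = m" using p by simp
  qed auto
  finally have S0: "(?f has_sum x * real p powr s) S0" .
  have "(?f has_sum (x + x * real p powr s)) (S1 \<union> S0)"
    by (rule has_sum_Un_disjoint[OF S1 S0]) (auto simp: S0_def S1_def)
  also have "S1 \<union> S0 = S" by (auto simp: S0_def S1_def)
  finally have "x + x * real p powr s = squarefree_sum s / (\<Prod>p\<in>T. 1 + real p powr s)"
    using IH by (rule has_sum_unique)
  hence "x * (1 + real p powr s) = squarefree_sum s / (\<Prod>p\<in>T. 1 + real p powr s)"
    by (simp only: ring_distribs mult_1_right)
  moreover have "1 + real p powr s > 0" by (intro add_pos_nonneg) auto
  ultimately have "x = squarefree_sum s / (\<Prod>p\<in>T. 1 + real p powr s) / (1 + real p powr s)"
    by (metis less_irrefl nonzero_eq_divide_eq)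
  hence "x = squarefree_sum s / (\<Prod>p\<in>insert p T. 1 + real p powr s)"
    using insert.hyps by (simp add: mult.commute)
  moreover have "S1 = {m. squarefree m \<and> (\<forall>q\<in>insert p T. q dvd m)}"
    by (auto simp: S1_def S_def)
  ultimately show ?case using S1 by simp
qed

lemma has_sum_squarefree_multiples_rad:
  assumes s: "s > 1" and Q: "Q > 0"
  shows "((\<lambda>m. real m powr - s) has_sum
            squarefree_sum s / (\<Prod>p\<in>prime_factors Q. 1 + real p powr s))
           {m. squarefree m \<and> rad Q dvd m}"
proof -
  have "(\<forall>p\<in>prime_factors Q. p dvd m) \<longleftrightarrow> rad Q dvd m" if "squarefree m" for m
  proof -
    have "m > 0" using that by (intro Nat.gr0I) auto
    thus ?thesis by (auto simp: rad_dvd_iff in_prime_factors_iff)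
  qed
  hence "{m. squarefree m \<and> (\<forall>p\<in>prime_factors Q. p dvd m)} = {m. squarefree m \<and> rad Q dvd m}"
    by blast
  thus ?thesis
    using has_sum_squarefree_multiples[OF s, of "prime_factors Q"] by auto
qed

lemma square_part_mult_square:
  assumes "squarefree (r :: nat)" "d > 0"
  shows "square_part (r * d ^ 2) = d"
proof -
  have "d dvd square_part (r * d ^ 2)" by (simp add: dvd_square_part_iff)
  then obtain t where t: "square_part (r * d ^ 2) = d * t" by (elim dvdE)
  have "(d * t) ^ 2 dvd r * d ^ 2" using square_part_square_dvd[of "r * d ^ 2"] t by simp
  hence "t ^ 2 * d ^ 2 dvd r * d ^ 2" by (simp add: power_mult_distrib mult.commute)
  hence "t ^ 2 dvd r" using assms(2) by simp
  hence "t = 1" using squarefreeD[OF assms(1), of t] by simp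
  thus ?thesis using t by simp
qed

lemma squarefree_part_mult_square:
  assumes "squarefree (r :: nat)" "d > 0"
  shows "squarefree_part (r * d ^ 2) = r"
proof -
  have "r * d ^ 2 = squarefree_part (r * d ^ 2) * d ^ 2"
    using squarefree_decompose[of "r * d ^ 2"] by (simp add: square_part_mult_square[OF assms])
  thus ?thesis using assms by simp
qed

text \<open>
  The decomposition \<open>n = r * d\<^sup>2\<close> with \<open>r\<close> squarefree is unique, which gives the classical identity
  that the squarefree numbers have Dirichlet series \<open>\<zeta>(s) / \<zeta>(2s)\<close>.
\<close>
lemma squarefree_sum_mult_zeta_sum:
  assumes s: "s > 1"
  shows "squarefree_sum s * zeta_sum (2 * s) = zeta_sum s"
proof -
  let ?f = "\<lambda>(r, d). real r powr - s * real d powr - (2 * s)"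
  let ?A = "{r::nat. squarefree r}" and ?B = "{0::nat<..}"
  have "((\<lambda>n. real n powr - s) has_sum zeta_sum s) ?B"
    using summable_on_powr[OF s] by (simp add: zeta_sum_def)
  also have "?this \<longleftrightarrow> (?f has_sum zeta_sum s) (?A \<times> ?B)"
  proof (rule has_sum_reindex_bij_witness
      [of _ "\<lambda>(r, d). r * d ^ 2" "\<lambda>n. (squarefree_part n, square_part n)"])
    fix n :: nat assume "n \<in> ?B"
    hence n: "n > 0" by simp
    show *: "(case (squarefree_part n, square_part n) of (r, d) \<Rightarrow> r * d ^ 2) = n"
      using squarefree_decompose[of n] by simp
    show "(squarefree_part n, square_part n) \<in> ?A \<times> ?B"
      using n square_part_0_iff[of n] by (auto simp del: square_part_0_iff)
    have "real n = real (squarefree_part n) * real (square_part n) ^ 2"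
      by (subst squarefree_decompose[of n]) simp
    also have "\<dots> powr - s = real (squarefree_part n) powr - s * real (square_part n) powr - (2 * s)"
      using powr_powr[of "real (square_part n)" 2 "- s"] by (simp add: powr_mult)
    finally show "?f (squarefree_part n, square_part n) = real n powr - s" by simp
  next
    fix x assume "x \<in> ?A \<times> ?B"
    then obtain r d where x: "x = (r, d)" "squarefree r" "d > 0" by auto
    have r: "r > 0" using x by (intro Nat.gr0I) auto
    show "(case x of (r, d) \<Rightarrow> r * d ^ 2) \<in> ?B" using x r by simp
    have "square_part (r * d ^ 2) = d \<and> squarefree_part (r * d ^ 2) = r"
      using x by (intro conjI square_part_mult_square squarefree_part_mult_square)
    thus "(squarefree_part (case x of (r, d) \<Rightarrow> r * d ^ 2),
           square_part (case x of (r, d) \<Rightarrow> r * d ^ 2)) = x"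
      using x by simp
  qed auto
  finally have *: "(?f has_sum zeta_sum s) (?A \<times> ?B)" .
  have z: "((\<lambda>d. real d powr - (2 * s)) has_sum zeta_sum (2 * s)) ?B"
    using summable_on_powr[of "2 * s"] s by (simp add: zeta_sum_def)
  have "((\<lambda>r. real r powr - s * zeta_sum (2 * s)) has_sum zeta_sum s) ?A"
    by (rule has_sum_SigmaD[OF *]) (use has_sum_cmult_right[OF z] in simp)
  moreover have "((\<lambda>r. real r powr - s * zeta_sum (2 * s)) has_sum
                    squarefree_sum s * zeta_sum (2 * s)) ?A"
    by (rule has_sum_cmult_left) (use summable_on_powr[OF s] in \<open>simp add: squarefree_sum_def\<close>)
  ultimately show ?thesis using has_sum_unique by blast
qed

section \<open>Behaviour at the pole\<close>

text \<open>
  Tannery's theorem for sums over a set of naturals, obtained by extending all terms by 0.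
\<close>
lemma tendsto_infsum_dominated:
  fixes g :: "'b \<Rightarrow> nat \<Rightarrow> real" and w :: "nat \<Rightarrow> real"
  assumes lim: "\<And>n. n \<in> S \<Longrightarrow> ((\<lambda>s. g s n) \<longlongrightarrow> h n) F"
      and bound: "eventually (\<lambda>s. \<forall>n\<in>S. norm (g s n) \<le> w n) F"
      and w: "w summable_on S" and F: "F \<noteq> bot"
  shows "h summable_on S" "((\<lambda>s. infsum (g s) S) \<longlongrightarrow> infsum h S) F"
proof -
  \<comment> \<open>The terms are extended by 0 to all of \<open>nat\<close>, where Tannery's theorem for series applies.\<close>
  define ext where "ext = (\<lambda>u n. if n \<in> S then u n else (0::real))"
  have suminf_ext: "suminf (ext u) = infsum u S" if "summable (\<lambda>n. norm (ext u n))" for u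
  proof -
    have "ext u sums suminf (ext u)"
      using that summable_norm_cancel summable_sums by blast
    hence "(ext u has_sum suminf (ext u)) UNIV"
      using that by (intro norm_summable_imp_has_sum)
    also have "?this \<longleftrightarrow> (u has_sum suminf (ext u)) S"
      by (rule has_sum_cong_neutral) (auto simp: ext_def)
    finally show ?thesis by (simp add: infsumI)
  qed
  have "ext w summable_on UNIV"
    using w by (rule summable_on_cong_neutral[THEN iffD1, rotated -1]) (auto simp: ext_def)
  hence w': "summable (ext w)" by (rule summable_on_imp_summable)
  have "eventually (\<lambda>(n, s). norm (ext (g s) n) \<le> ext w n) (at_top \<times>\<^sub>F F)"
    unfolding eventually_prod_filter
    by (rule exI[of _ "\<lambda>_. True"], rule exI[of _ "\<lambda>s. \<forall>n\<in>S. norm (g s n) \<le> w n"])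
       (use bound in \<open>auto simp: ext_def\<close>)
  moreover have "((\<lambda>s. ext (g s) n) \<longlongrightarrow> ext h n) F" for n
    using lim by (auto simp: ext_def)
  ultimately have *: "eventually (\<lambda>s. summable (\<lambda>n. norm (ext (g s) n))) F"
      "summable (\<lambda>n. norm (ext h n))" "((\<lambda>s. suminf (ext (g s))) \<longlongrightarrow> suminf (ext h)) F"
    using tannerys_theorem[of "\<lambda>n s. ext (g s) n" "ext h" F "ext w"] w' F by auto
  show "h summable_on S"
  proof -
    have "ext h summable_on UNIV"
      using norm_summable_imp_summable_on[OF *(2)] .
    thus ?thesis
      by (rule summable_on_cong_neutral[THEN iffD1, rotated -1]) (auto simp: ext_def)
  qed
  have "eventually (\<lambda>s. suminf (ext (g s)) = infsum (g s) S) F"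
    using *(1) by eventually_elim (rule suminf_ext)
  from Lim_transform_eventually[OF *(3) this] 
  show "((\<lambda>s. infsum (g s) S) \<longlongrightarrow> infsum h S) F"
    by (simp add: suminf_ext[OF *(2)])
qed

lemma zeta_sum_2: "zeta_sum 2 = pi\<^sup>2 / 6"
proof -
  have "((\<lambda>n. 1 / (real n + 1)\<^sup>2) has_sum (pi\<^sup>2 / 6)) UNIV"
    using inverse_squares_sums by (intro sums_nonneg_imp_has_sum) (auto simp: add.commute)
  also have "?this \<longleftrightarrow> ((\<lambda>n. real n powr - 2) has_sum (pi\<^sup>2 / 6)) {0<..}"
    by (rule has_sum_reindex_bij_witness[of _ "\<lambda>n. n - 1" Suc])
       (auto simp: powr_minus field_simps powr_numeral)
  finally show ?thesis by (simp add: zeta_sum_def infsumI)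
qed

lemma tendsto_zeta_sum_2: "((\<lambda>s. zeta_sum (2 * s)) \<longlongrightarrow> pi\<^sup>2 / 6) (at_right 1)"
proof -
  have "((\<lambda>s. \<Sum>\<^sub>\<infinity>n\<in>{0<..}. real n powr - (2 * s)) \<longlongrightarrow>
           (\<Sum>\<^sub>\<infinity>n\<in>{0<..}. real n powr - (2 * 1))) (at_right 1)"
  proof (rule tendsto_infsum_dominated(2))
    show "((\<lambda>s. real n powr - (2 * s)) \<longlongrightarrow> real n powr - (2 * 1)) (at_right 1)"
      if "n \<in> {0<..}" for n
      using that by (intro tendsto_intros) auto
    show "eventually (\<lambda>s. \<forall>n\<in>{0<..}. norm (real n powr - (2 * s)) \<le> real n powr - 2) (at_right 1)"
      using eventually_at_right_less[of 1]
      by eventually_elim (auto intro!: powr_mono)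
    show "(\<lambda>n. real n powr - 2) summable_on {0<..}" by (rule summable_on_powr) auto
  qed auto
  thus ?thesis unfolding zeta_sum_2[symmetric] by (simp add: zeta_sum_def)
qed

lemma zeta_sum_at_top: "filterlim zeta_sum at_top (at_right 1)"
  unfolding filterlim_at_top
proof
  fix Z :: real
  \<comment> \<open>The partial sums of the harmonic series are unbounded and approximated by those at \<open>s > 1\<close>.\<close>
  have "\<not> (\<exists>C. \<forall>N. (\<Sum>n=1..N. real n powr - 1) \<le> C)"
  proof
    assume "\<exists>C. \<forall>N. (\<Sum>n=1..N. real n powr - 1) \<le> C"
    then obtain C where C: "\<And>N. (\<Sum>n=1..N. real n powr - 1) \<le> C" by blast
    have "summable (\<lambda>n. real n powr - 1)"
    proof (rule bounded_imp_summable)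
      show "(\<Sum>n\<le>N. real n powr - 1) \<le> C" for N
      proof -
        have "(\<Sum>n\<le>N. real n powr - 1) = (\<Sum>n=1..N. real n powr - 1)"
          by (rule sum.mono_neutral_right) (auto simp: not_less_eq_eq)
        thus ?thesis using C[of N] by simp
      qed
    qed auto
    thus False using summable_real_powr_iff[of "- 1"] by simp
  qed
  then obtain N where N: "(\<Sum>n=1..N. real n powr - 1) > Z" by (meson not_le)
  have "((\<lambda>s. \<Sum>n=1..N. real n powr - s) \<longlongrightarrow> (\<Sum>n=1..N. real n powr - 1)) (at_right 1)"
    by (intro tendsto_intros) auto
  hence "eventually (\<lambda>s. (\<Sum>n=1..N. real n powr - s) > Z) (at_right 1)"
    using N by (rule order_tendstoD)
  thus "eventually (\<lambda>s. Z \<le> zeta_sum s) (at_right 1)"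
    using eventually_at_right_less[of 1]
  proof eventually_elim
    case (elim s)
    have "(\<Sum>n=1..N. real n powr - s) \<le> zeta_sum s"
      unfolding zeta_sum_def
      by (rule finite_sum_le_infsum) (use elim summable_on_powr in auto)
    thus ?case using elim by simp
  qed
qed

text \<open>
  Summation by parts against \<open>n powr - s\<close>, whose differences are at most \<open>2 * n powr - 2\<close> for
  \<open>1 < s \<le> 2\<close>. The bound is uniform in \<open>s\<close> because \<open>\<Sum>n. n powr (\<theta> - 2)\<close> converges for \<open>\<theta> < 1\<close>;
  this uniformity is what lets \<open>s\<close> tend to 1 later.
\<close>
lemma dirichlet_series_bounded:
  fixes c :: "nat \<Rightarrow> real" and \<theta> :: real
  assumes \<theta>: "\<theta> < 1"
      and C: "\<And>N. N \<ge> 1 \<Longrightarrow> \<bar>\<Sum>n=1..N. c n\<bar> \<le> C * real N powr \<theta>"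
  obtains K where "\<And>s N. 1 < s \<Longrightarrow> s \<le> 2 \<Longrightarrow> \<bar>\<Sum>n=1..N. c n * real n powr - s\<bar> \<le> K"
proof
  define L where "L = (\<Sum>n. real n powr (\<theta> - 2))"
  fix s :: real and N :: nat
  assume s: "1 < s" "s \<le> 2"
  define S where "S = (\<lambda>N. \<Sum>n=1..N. c n)"
  define u where "u = (\<lambda>n::nat. real n powr - s)"
  have C0: "C \<ge> 0" using C[of 1] by simp
  have parts: "(\<Sum>n=1..N. c n * u n) = S N * u N + (\<Sum>n=1..<N. S n * (u n - u (Suc n)))"
  proof (induction N)
    case (Suc N)
    show ?case
    proof (cases "N = 0")
      case False
      thus ?thesis using Suc by (simp add: S_def algebra_simps)
    qed (simp add: S_def)
  qed (simp add: S_def)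
  have diff: "\<bar>u n - u (Suc n)\<bar> \<le> 2 * real n powr - 2" if n: "n \<ge> 1" for n
  proof -
    have "\<exists>z. real n < z \<and> z < real (Suc n) \<and>
            real (Suc n) powr - s - real n powr - s = (real (Suc n) - real n) * (- s * z powr (- s - 1))"
      using n by (intro MVT2) (auto intro!: derivative_eq_intros)
    then obtain z where z: "real n < z" "u (Suc n) - u n = - s * z powr (- s - 1)"
      by (auto simp: u_def)
    have "\<bar>u n - u (Suc n)\<bar> = s * z powr (- s - 1)"
      using s by (subst abs_minus_commute) (simp add: z(2) abs_mult)
    also have "z powr (- s - 1) \<le> real n powr (- s - 1)"
      using z n s by (intro powr_mono2') auto
    also have "real n powr (- s - 1) \<le> real n powr - 2"
      using s n by (intro powr_mono) auto
    also have "s * real n powr - 2 \<le> 2 * real n powr - 2"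
      using s by (intro mult_right_mono) auto
    finally show ?thesis using s by simp
  qed
  have "\<bar>S N * u N\<bar> \<le> C"
  proof (cases "N = 0")
    case False
    hence N: "N \<ge> 1" by simp
    have "\<bar>S N * u N\<bar> \<le> (C * real N powr \<theta>) * real N powr - s"
      using C[OF N] by (simp add: S_def u_def abs_mult mult_right_mono)
    also have "\<dots> = C * real N powr (\<theta> - s)"
      by (simp add: powr_add[symmetric] mult.assoc)
    also have "real N powr (\<theta> - s) \<le> real N powr 0"
      using N s \<theta> by (intro powr_mono) auto
    hence "C * real N powr (\<theta> - s) \<le> C" using C0 N by (simp add: mult_left_le)
    finally show ?thesis .
  qed (use C0 in \<open>simp add: S_def\<close>)
  moreover have "\<bar>\<Sum>n=1..<N. S n * (u n - u (Suc n))\<bar> \<le> 2 * C * L"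
  proof -
    have "\<bar>\<Sum>n=1..<N. S n * (u n - u (Suc n))\<bar> \<le> (\<Sum>n=1..<N. \<bar>S n * (u n - u (Suc n))\<bar>)"
      by (rule sum_abs)
    also have "\<dots> \<le> (\<Sum>n=1..<N. 2 * C * real n powr (\<theta> - 2))"
    proof (rule sum_mono)
      fix n assume "n \<in> {1..<N}"
      hence n: "n \<ge> 1" by simp
      have "\<bar>S n * (u n - u (Suc n))\<bar> \<le> (C * real n powr \<theta>) * (2 * real n powr - 2)"
        unfolding abs_mult using C[OF n] diff[OF n] C0 by (intro mult_mono) (auto simp: S_def)
      also have "\<dots> = 2 * C * (real n powr \<theta> * real n powr - 2)" by simp
      also have "real n powr \<theta> * real n powr - 2 = real n powr (\<theta> - 2)"
        by (simp add: powr_add[symmetric])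
      finally show "\<bar>S n * (u n - u (Suc n))\<bar> \<le> 2 * C * real n powr (\<theta> - 2)" .
    qed
    also have "\<dots> = 2 * C * (\<Sum>n=1..<N. real n powr (\<theta> - 2))" by (simp add: sum_distrib_left)
    also have "(\<Sum>n=1..<N. real n powr (\<theta> - 2)) \<le> L"
      unfolding L_def by (rule sum_le_suminf) (use \<theta> in \<open>auto simp: summable_real_powr_iff\<close>)
    hence "2 * C * (\<Sum>n=1..<N. real n powr (\<theta> - 2)) \<le> 2 * C * L"
      using C0 by (simp add: mult_left_mono)
    finally show ?thesis .
  qed
  ultimately show "\<bar>\<Sum>n=1..N. c n * real n powr - s\<bar> \<le> C + 2 * C * L"
    using parts by (simp add: u_def)
qed

section \<open>The Dirichlet series of integers with a given number of distinct exponents\<close>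

text \<open>
  The coefficient with which \<open>Q\<close> enters: \<open>squarefree_sum s * euler_weight s Q\<close> is the sum of
  \<open>(Q * m) powr - s\<close> over the squarefree multiples \<open>m\<close> of \<open>rad Q\<close>. At \<open>s = 1\<close> the product is
  \<open>dedekind_psi (rad Q)\<close>.
\<close>
definition euler_weight :: "real \<Rightarrow> nat \<Rightarrow> real" where
  "euler_weight s Q = real Q powr - s / (\<Prod>p\<in>prime_factors Q. 1 + real p powr s)"

lemma rad_powr_le_prod:
  assumes "s \<ge> 1"
  shows "real (rad Q) \<le> (\<Prod>p\<in>prime_factors Q. 1 + real p powr s)"
proof -
  have "(\<Prod>p\<in>prime_factors Q. real p) \<le> (\<Prod>p\<in>prime_factors Q. 1 + real p powr s)"
  proof (rule prod_mono, intro conjI)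
    fix p assume "p \<in> prime_factors Q"
    hence "p \<ge> 1" using prime_ge_1_nat by auto
    hence "real p powr 1 \<le> real p powr s" using assms by (intro powr_mono) auto
    thus "real p \<le> 1 + real p powr s" using \<open>p \<ge> 1\<close> by simp
  qed auto
  thus ?thesis by (simp add: rad_def)
qed

lemma euler_weight_bound:
  assumes "s \<ge> 1" "Q > 0"
  shows "\<bar>euler_weight s Q\<bar> \<le> 1 / (real Q * real (rad Q))"
proof -
  have "real Q powr - s \<le> real Q powr - 1" using assms by (intro powr_mono) auto
  hence 1: "real Q powr - s \<le> 1 / real Q" using assms by (simp add: powr_minus field_simps)
  have "0 < real (rad Q)" by simp
  with rad_powr_le_prod[of s Q] assms 1 
  have "real Q powr - s / (\<Prod>p\<in>prime_factors Q. 1 + real p powr s) \<le> (1 / real Q) / real (rad Q)"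
    by (intro frac_le) auto
  moreover have "0 \<le> euler_weight s Q"
    unfolding euler_weight_def by (intro divide_nonneg_nonneg prod_nonneg) auto
  ultimately show ?thesis by (simp add: euler_weight_def)
qed

lemma tendsto_euler_weight_sum:
  assumes "S \<subseteq> {0<..}"
  shows "euler_weight 1 summable_on S"
    and "((\<lambda>s. infsum (euler_weight s) S) \<longlongrightarrow> infsum (euler_weight 1) S) (at_right 1)"
proof -
  have *: "((\<lambda>s. euler_weight s Q) \<longlongrightarrow> euler_weight 1 Q) (at_right 1)" if "Q \<in> S" for Q
  proof -
    have "(\<Prod>p\<in>prime_factors Q. 1 + real p powr 1) \<noteq> 0"
      using rad_powr_le_prod[of 1 Q] rad_pos[of Q] by linarith
    moreover have "real p \<noteq> 0" if "p \<in> prime_factors Q" for p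
      using that in_prime_factors_imp_prime prime_gt_0_nat by fastforce
    ultimately show ?thesis
      using that assms unfolding euler_weight_def by (intro tendsto_intros) auto
  qed
  have **: "\<forall>\<^sub>F s in at_right 1. \<forall>Q\<in>S. norm (euler_weight s Q) \<le> 1 / (real Q * real (rad Q))"
    using eventually_at_right_less[of 1]
    by eventually_elim (use assms in \<open>auto intro!: euler_weight_bound\<close>)
  have ***: "(\<lambda>Q. 1 / (real Q * real (rad Q))) summable_on S"
    using summable_on_inverse_mult_rad assms by (rule summable_on_subset)
  show "euler_weight 1 summable_on S"
    by (rule tendsto_infsum_dominated(1)[OF * ** ***]) auto
  show "((\<lambda>s. infsum (euler_weight s) S) \<longlongrightarrow> infsum (euler_weight 1) S) (at_right 1)"
    by (rule tendsto_infsum_dominated(2)[OF * ** ***]) auto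
qed

text \<open>
  Sum over \<open>n = Q * m\<close> with \<open>m = rad n\<close>, for fixed \<open>Q\<close> first. If \<open>Q\<close> has \<open>k - 1\<close> distinct exponents,
  all squarefree multiples \<open>m\<close> of \<open>rad Q\<close> occur except \<open>rad Q\<close> itself; if \<open>Q\<close> has \<open>k\<close>, only
  \<open>m = rad Q\<close> occurs. The deviations at \<open>m = rad Q\<close> belong to the powerful numbers \<open>Q * rad Q\<close>, and
  their total stays bounded as \<open>s\<close> tends to 1.
\<close>
lemma exponent_count_series_approx:
  assumes s: "s > 1"
  shows "\<bar>(\<Sum>\<^sub>\<infinity>n | n > 0 \<and> num_exponents n = k. real n powr - s) -
           squarefree_sum s * (\<Sum>\<^sub>\<infinity>Q | Q > 0 \<and> Suc (num_exponents Q) = k. euler_weight s Q)\<bar>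
         \<le> (\<Sum>\<^sub>\<infinity>Q\<in>{0<..}. 1 / (real Q * real (rad Q)))"
proof -
  define N where "N = {n::nat. n > 0 \<and> num_exponents n = k}"
  define F where "F = (\<Sum>\<^sub>\<infinity>n\<in>N. real n powr - s)"
  define M where "M = (\<lambda>Q. {m. squarefree m \<and> rad Q dvd m})"
  define B where "B = (\<lambda>Q. {m\<in>M Q. num_exponents Q + (if rad Q = m then 0 else 1) = k})"
  define h where "h = (\<lambda>(Q, m). real Q powr - s * real m powr - s)"
  \<comment> \<open>\<open>e Q\<close> is the full sum over all squarefree multiples of \<open>rad Q\<close>, \<open>c Q\<close> the correction at \<open>rad Q\<close>.\<close>
  define c where "c = (\<lambda>Q. real Q powr - s * (if Suc (num_exponents Q) = k then - (real (rad Q) powr - s)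
                             else if num_exponents Q = k then real (rad Q) powr - s else 0))"
  define e where "e = (\<lambda>Q. if Suc (num_exponents Q) = k then squarefree_sum s * euler_weight s Q else 0)"
  define w where "w = (\<lambda>Q. 1 / (real Q * real (rad Q)))"
  have "((\<lambda>n. real n powr - s) has_sum F) N"
    unfolding F_def using summable_on_powr[OF s] by simp
  also have "?this \<longleftrightarrow> (h has_sum F) (Sigma {0<..} B)"
  proof (rule has_sum_reindex_bij_witness[of _ "\<lambda>(Q, m). Q * m" "\<lambda>n. (n div rad n, rad n)"])
    fix n assume "n \<in> N"
    hence n: "n > 0" "num_exponents n = k" by (auto simp: N_def)
    define Q where "Q = n div rad n"
    have nQ: "n = Q * rad n" using rad_dvd[OF n(1)] by (simp add: Q_def)
    have Q: "Q > 0" using n nQ by (metis mult_0 neq0_conv)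
    have dv: "rad Q dvd rad n" unfolding Q_def by (rule rad_div_rad_dvd[OF n(1)])
    have "num_exponents (Q * rad n) = num_exponents Q + (if rad Q = rad n then 0 else 1)"
      by (rule num_exponents_mult) (use Q dv in auto)
    hence "num_exponents Q + (if rad Q = rad n then 0 else 1) = k" using n(2) nQ by simp
    thus "(n div rad n, rad n) \<in> Sigma {0<..} B"
      unfolding Q_def[symmetric] using Q dv by (simp add: B_def M_def)
    show "(case (n div rad n, rad n) of (Q, m) \<Rightarrow> Q * m) = n"
      using rad_dvd[OF n(1)] by simp
    have "real n = real Q * real (rad n)" by (subst nQ) simp
    hence "real n powr - s = real Q powr - s * real (rad n) powr - s" by (simp add: powr_mult)
    thus "h (n div rad n, rad n) = real n powr - s"
      by (simp only: h_def Q_def[symmetric] prod.case)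
  next
    fix x assume "x \<in> Sigma {0<..} B"
    then obtain Q m where x: "x = (Q, m)" "Q > 0" "m \<in> B Q" by auto
    have m: "squarefree m" "rad Q dvd m" using x by (auto simp: B_def M_def)
    have m0: "m > 0" using m by (intro Nat.gr0I) auto
    have "num_exponents (Q * m) = k"
      using num_exponents_mult[OF x(2) m] x(3) by (simp add: B_def)
    thus "(case x of (Q, m) \<Rightarrow> Q * m) \<in> N" using x m0 by (simp add: N_def)
    show "((case x of (Q, m) \<Rightarrow> Q * m) div rad (case x of (Q, m) \<Rightarrow> Q * m),
           rad (case x of (Q, m) \<Rightarrow> Q * m)) = x"
      using x m m0 by (simp add: rad_mult)
  qed auto
  finally have hF: "(h has_sum F) (Sigma {0<..} B)" .
  have inner: "((\<lambda>m. h (Q, m)) has_sum (e Q + c Q)) (B Q)" if "Q \<in> {0<..}" for Q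
  proof -
    have Q: "Q > 0" using that by simp
    define E where "E = squarefree_sum s / (\<Prod>p\<in>prime_factors Q. 1 + real p powr s)"
    have radM: "rad Q \<in> M Q" by (simp add: M_def)
    have "\<exists>b. ((\<lambda>m. real m powr - s) has_sum b) (B Q) \<and> real Q powr - s * b = e Q + c Q"
    proof (cases "Suc (num_exponents Q) = k")
      case True
      have B: "B Q = M Q - {rad Q}" using True by (auto simp: B_def)
      have "((\<lambda>m. real m powr - s) has_sum (E - real (rad Q) powr - s)) (B Q)"
        unfolding B
      proof (rule has_sum_Diff)
        show "((\<lambda>m. real m powr - s) has_sum E) (M Q)"
          unfolding E_def M_def by (rule has_sum_squarefree_multiples_rad[OF s Q])
      qed (use radM in \<open>auto intro: has_sum_finiteI\<close>)
      moreover have "real Q powr - s * (E - real (rad Q) powr - s) = e Q + c Q"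
        using True by (simp add: e_def c_def E_def euler_weight_def algebra_simps)
      ultimately show ?thesis by blast
    next
      case False
      hence "B Q = (if num_exponents Q = k then {rad Q} else {})"
        using radM by (auto simp: B_def split: if_splits)
      hence "((\<lambda>m. real m powr - s) has_sum (if num_exponents Q = k then real (rad Q) powr - s else 0)) (B Q)"
        by (auto intro: has_sum_finiteI)
      thus ?thesis using False by (auto simp: e_def c_def)
    qed
    then obtain b where b: "((\<lambda>m. real m powr - s) has_sum b) (B Q)" "real Q powr - s * b = e Q + c Q"
      by blast
    show ?thesis
      using has_sum_cmult_right[OF b(1), of "real Q powr - s"] b(2) by (simp add: h_def)
  qed
  have F: "((\<lambda>Q. e Q + c Q) has_sum F) {0<..}"
    by (rule has_sum_SigmaD[OF hF inner])
  have cw: "norm (c Q) \<le> w Q" if "Q \<in> {0<..}" for Q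
  proof -
    have *: "real n powr - s \<le> 1 / real n" if "n > 0" for n :: nat
      using powr_mono[of "- s" "- 1" "real n"] s that by (simp add: powr_minus field_simps)
    have "norm (c Q) \<le> real Q powr - s * real (rad Q) powr - s"
      unfolding c_def by (auto simp: abs_mult)
    also have "\<dots> \<le> (1 / real Q) * (1 / real (rad Q))"
      using that by (intro mult_mono *) auto
    finally show ?thesis by (simp add: w_def)
  qed
  have w: "w summable_on {0<..}"
    unfolding w_def by (rule summable_on_inverse_mult_rad)
  have "(\<lambda>Q. norm (c Q)) summable_on {0<..}"
    by (rule summable_on_comparison_test[OF w]) (simp_all only: cw norm_ge_zero)
  hence "c summable_on {0<..}" by (rule abs_summable_summable)
  hence c: "(c has_sum infsum c {0<..}) {0<..}" by (rule has_sum_infsum)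
  have "(e has_sum (F - infsum c {0<..})) {0<..}"
    using has_sum_add[OF F has_sum_uminusI[OF c]] by simp
  also have "?this \<longleftrightarrow> ((\<lambda>Q. squarefree_sum s * euler_weight s Q) has_sum (F - infsum c {0<..}))
               {Q. Q > 0 \<and> Suc (num_exponents Q) = k}"
    by (rule has_sum_cong_neutral) (auto simp: e_def)
  finally have "F - infsum c {0<..} =
      (\<Sum>\<^sub>\<infinity>Q | Q > 0 \<and> Suc (num_exponents Q) = k. squarefree_sum s * euler_weight s Q)"
    by (simp add: infsumI)
  also have "\<dots> = squarefree_sum s * (\<Sum>\<^sub>\<infinity>Q | Q > 0 \<and> Suc (num_exponents Q) = k. euler_weight s Q)"
    by (rule infsum_cmult_right')
  finally have "F - squarefree_sum s * (\<Sum>\<^sub>\<infinity>Q | Q > 0 \<and> Suc (num_exponents Q) = k. euler_weight s Q)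
                  = infsum c {0<..}" by simp
  moreover have "\<bar>infsum c {0<..}\<bar> \<le> infsum w {0<..}"
    using norm_infsum_le[OF c has_sum_infsum[OF w] cw] by simp
  ultimately show ?thesis by (simp add: F_def N_def w_def)
qed

lemma dedekind_psi_squarefree:
  assumes "squarefree n"
  shows "dedekind_psi n = (\<Prod>p\<in>prime_factors n. 1 + real p)"
proof -
  have "real (rad n) = (\<Prod>p\<in>prime_factors n. real p)"
    by (simp add: rad_def)
  hence "real n = (\<Prod>p\<in>prime_factors n. real p)"
    by (simp only: rad_squarefree[OF assms])
  hence "dedekind_psi n = (\<Prod>p\<in>prime_factors n. real p * (1 + 1 / real p))"
    unfolding dedekind_psi_def by (simp add: prod.distrib)
  also have "\<dots> = (\<Prod>p\<in>prime_factors n. 1 + real p)"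
  proof (intro prod.cong refl)
    fix p assume "p \<in> prime_factors n"
    hence "p > 0" using in_prime_factors_imp_prime prime_gt_0_nat by blast
    thus "real p * (1 + 1 / real p) = 1 + real p" by (simp add: field_simps)
  qed
  finally show ?thesis .
qed

lemma rho_eq_0: "\<not> squarefree n \<Longrightarrow> rho k n = 0"
  by (cases "(k, n)" rule: rho.cases) auto

text \<open>
  Group the integers \<open>Q\<close> by their radical \<open>n\<close>, which determines the product in \<open>euler_weight\<close>.
\<close>
lemma has_sum_rho_div_psi:
  assumes "(euler_weight 1 has_sum T) {Q. Q > 0 \<and> num_exponents Q = k}"
  shows "((\<lambda>n. rho (Suc k) n / dedekind_psi n) has_sum T) {0<..}"
proof -
  define X where "X = (\<lambda>n. {Q. Q > 0 \<and> rad Q = n \<and> num_exponents Q = k})"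
  have "(euler_weight 1 has_sum T) {Q. Q > 0 \<and> num_exponents Q = k}" by (rule assms)
  also have "?this \<longleftrightarrow> ((\<lambda>(n, Q). euler_weight 1 Q) has_sum T) (Sigma {n. squarefree n} X)"
    by (rule has_sum_reindex_bij_witness[of _ snd "\<lambda>Q. (rad Q, Q)"]) (auto simp: X_def)
  finally have *: "((\<lambda>(n, Q). euler_weight 1 Q) has_sum T) (Sigma {n. squarefree n} X)" .
  have "((\<lambda>n. rho (Suc k) n / dedekind_psi n) has_sum T) {n. squarefree n}"
  proof (rule has_sum_SigmaD[OF *])
    fix n :: nat assume "n \<in> {n. squarefree n}"
    hence n: "squarefree n" by simp
    have "((\<lambda>Q. 1 / real Q / dedekind_psi n) has_sum rho (Suc k) n / dedekind_psi n) (X n)"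
      unfolding X_def by (rule has_sum_divide_const[OF has_sum_rho[OF n]])
    also have "?this \<longleftrightarrow> ((\<lambda>Q. euler_weight 1 Q) has_sum rho (Suc k) n / dedekind_psi n) (X n)"
    proof (rule has_sum_cong_neutral)
      fix Q assume "Q \<in> X n \<inter> X n"
      hence Q: "Q > 0" "rad Q = n" by (auto simp: X_def)
      hence "prime_factors n = prime_factors Q" by auto
      thus "1 / real Q / dedekind_psi n = euler_weight 1 Q"
        using Q(1) by (simp add: euler_weight_def dedekind_psi_squarefree[OF n] powr_minus field_simps)
    qed auto
    finally show "((\<lambda>Q. case (n, Q) of (n, Q) \<Rightarrow> euler_weight 1 Q) has_sum
                     rho (Suc k) n / dedekind_psi n) (X n)" by simp
  qed
  also have "?this \<longleftrightarrow> ((\<lambda>n. rho (Suc k) n / dedekind_psi n) has_sum T) {0<..}"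
  proof (rule has_sum_cong_neutral)
    fix n :: nat assume "n \<in> {0<..} - {n. squarefree n}"
    thus "rho (Suc k) n / dedekind_psi n = 0" by (simp add: rho_eq_0)
  next
    fix n :: nat assume "n \<in> {n. squarefree n} - {0<..}"
    hence "n = 0" "squarefree n" by auto
    hence False using not_squarefree_0 by metis
    thus "rho (Suc k) n / dedekind_psi n = 0" ..
  qed simp
  finally show ?thesis .
qed

section \<open>From densities to Dirichlet series\<close>

text \<open>
  The characteristic property applied to the indicator of \<open>k\<close>, with \<open>a = 2\<close> and \<open>\<epsilon> = 1/4\<close>; any
  \<open>\<epsilon> < 1/2\<close> would keep the exponent below 1.
\<close>
lemma exponent_densities_count:
  assumes "exponent_densities A" and k: "k \<ge> 1"
  obtains C where "\<And>N. N \<ge> 1 \<Longrightarrow>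
    \<bar>\<Sum>n=1..N. (if num_exponents n = k then 1 else 0) - A k\<bar> \<le> C * real N powr (3/4)"
proof -
  define \<phi> where "\<phi> = (\<lambda>j. if j = k then 1 else 0 :: complex)"
  have \<phi>: "\<phi> 0 = 0 \<and> (\<forall>j\<ge>1. norm (\<phi> j) < 2 ^ j)"
    using k by (auto simp: \<phi>_def)
  have "(\<lambda>j. of_real (A (Suc j)) * \<phi> (Suc j)) sums (\<Sum>j\<in>{k - 1}. of_real (A (Suc j)) * \<phi> (Suc j))"
    by (rule sums_finite) (use k in \<open>auto simp: \<phi>_def\<close>)
  hence M: "(\<Sum>j. of_real (A (Suc j)) * \<phi> (Suc j)) = of_real (A k)"
    using k by (simp add: sums_iff \<phi>_def)
  have "\<forall>\<epsilon>>0. \<exists>C::real. \<forall>\<phi>::nat \<Rightarrow> complex.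
           \<phi> 0 = 0 \<and> (\<forall>k\<ge>1. norm (\<phi> k) < 2 ^ k) \<longrightarrow>
           (\<forall>x::real. x \<ge> 1 \<longrightarrow>
              norm ((\<Sum>n | 1 \<le> n \<and> real n \<le> x. \<phi> (num_exponents n)) -
                    (\<Sum>k. of_real (A (Suc k)) * \<phi> (Suc k)) * of_real x)
                \<le> C * x powr (1 / 2 + \<epsilon>))"
    using assms(1) unfolding exponent_densities_def by (elim conjE allE[of _ 2]) simp
  from this[rule_format, of "1/4"] obtain C where C: "\<And>\<phi>::nat \<Rightarrow> complex. \<And>x::real.
      \<phi> 0 = 0 \<and> (\<forall>k\<ge>1. norm (\<phi> k) < 2 ^ k) \<Longrightarrow> x \<ge> 1 \<Longrightarrow>
        norm ((\<Sum>n | 1 \<le> n \<and> real n \<le> x. \<phi> (num_exponents n)) -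
              (\<Sum>k. of_real (A (Suc k)) * \<phi> (Suc k)) * of_real x) \<le> C * x powr (1 / 2 + 1 / 4)"
    by auto
  show ?thesis
  proof (rule that[of C])
    fix N :: nat assume N: "N \<ge> 1"
    have "{n. 1 \<le> n \<and> real n \<le> real N} = {1..N}" by auto
    moreover have "(\<Sum>n=1..N. \<phi> (num_exponents n)) - of_real (A k) * of_real (real N) =
        of_real (\<Sum>n=1..N. (if num_exponents n = k then 1 else 0) - A k)"
      by (simp add: sum_subtractf \<phi>_def if_distrib[of of_real] mult.commute cong: if_cong)
    ultimately show "\<bar>\<Sum>n=1..N. (if num_exponents n = k then 1 else 0) - A k\<bar> \<le> C * real N powr (3/4)"
      using C[OF \<phi>, of "real N"] N unfolding M by (simp only: norm_of_real) simp
  qed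
qed

text \<open>
  An Abelian theorem: the density of \<open>{n. num_exponents n = k}\<close> is recovered from the behaviour of
  its Dirichlet series near \<open>s = 1\<close>, since the two series below differ by a bounded amount while
  \<open>zeta_sum s\<close> tends to infinity.
\<close>
lemma exponent_densities_series_bound:
  assumes "exponent_densities A" and k: "k \<ge> 1"
  obtains K where "\<And>s. 1 < s \<Longrightarrow> s \<le> 2 \<Longrightarrow>
    \<bar>(\<Sum>\<^sub>\<infinity>n | n > 0 \<and> num_exponents n = k. real n powr - s) - A k * zeta_sum s\<bar> \<le> K"
proof -
  define a where "a = (\<lambda>n. if num_exponents n = k then 1 else 0 :: real)"
  obtain C where C: "\<And>N. N \<ge> 1 \<Longrightarrow> \<bar>\<Sum>n=1..N. a n - A k\<bar> \<le> C * real N powr (3/4)"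
    using exponent_densities_count[OF assms] unfolding a_def by blast
  obtain K where K: "\<And>s N. 1 < s \<Longrightarrow> s \<le> 2 \<Longrightarrow> \<bar>\<Sum>n=1..N. (a n - A k) * real n powr - s\<bar> \<le> K"
    by (rule dirichlet_series_bounded[OF _ C]) auto
  show ?thesis
  proof (rule that[of K])
    fix s :: real assume s: "1 < s" "s \<le> 2"
    define F where "F = (\<Sum>\<^sub>\<infinity>n | n > 0 \<and> num_exponents n = k. real n powr - s)"
    let ?g = "\<lambda>n. (a n - A k) * real n powr - s"
    have "((\<lambda>n. real n powr - s) has_sum F) {n. n > 0 \<and> num_exponents n = k}"
      unfolding F_def using summable_on_powr[OF s(1)] by simp
    also have "?this \<longleftrightarrow> ((\<lambda>n. a n * real n powr - s) has_sum F) {0<..}"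
      by (rule has_sum_cong_neutral) (auto simp: a_def)
    finally have F: "((\<lambda>n. a n * real n powr - s) has_sum F) {0<..}" .
    have "((\<lambda>n. A k * real n powr - s) has_sum A k * zeta_sum s) {0<..}"
      unfolding zeta_sum_def by (intro has_sum_cmult_right has_sum_infsum summable_on_powr s(1))
    from has_sum_add[OF F has_sum_uminusI[OF this]] have "(?g has_sum (F - A k * zeta_sum s)) {0<..}"
      by (simp add: algebra_simps)
    also have "?this \<longleftrightarrow> ((\<lambda>n. ?g (Suc n)) has_sum (F - A k * zeta_sum s)) UNIV"
      by (rule has_sum_reindex_bij_witness[of _ Suc "\<lambda>n. n - 1"]) auto
    finally have "(\<lambda>n. ?g (Suc n)) sums (F - A k * zeta_sum s)"
      by (rule has_sum_imp_sums)
    hence "(\<lambda>N. \<bar>\<Sum>n<N. ?g (Suc n)\<bar>) \<longlonglongrightarrow> \<bar>F - A k * zeta_sum s\<bar>"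
      unfolding sums_def by (rule tendsto_rabs)
    moreover have "\<bar>\<Sum>n<N. ?g (Suc n)\<bar> \<le> K" for N
      using K[OF s, of N] by (simp add: sum.atLeast1_atMost_eq)
    ultimately show "\<bar>F - A k * zeta_sum s\<bar> \<le> K"
      by (intro LIMSEQ_le_const2) auto
  qed
qed

section \<open>The formula for the densities\<close>

theorem theorem1p2:
  fixes A :: "nat \<Rightarrow> real" and k :: nat
  assumes "exponent_densities A" and "k \<ge> 1"
  shows "summable (\<lambda>n. rho k (Suc n) / dedekind_psi (Suc n)) \<and>
         A k = 6 / pi\<^sup>2 * (\<Sum>n. rho k (Suc n) / dedekind_psi (Suc n))"
proof -
  define S where "S = {Q. Q > 0 \<and> Suc (num_exponents Q) = k}"
  define T where "T = (\<lambda>s. infsum (euler_weight s) S)"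
  define W where "W = (\<Sum>\<^sub>\<infinity>Q\<in>{0<..}. 1 / (real Q * real (rad Q)))"
  obtain K where K: "\<And>s. 1 < s \<Longrightarrow> s \<le> 2 \<Longrightarrow>
    \<bar>(\<Sum>\<^sub>\<infinity>n | n > 0 \<and> num_exponents n = k. real n powr - s) - A k * zeta_sum s\<bar> \<le> K"
    using exponent_densities_series_bound[OF assms] by blast
  have pi: "pi\<^sup>2 / 6 > 0" by simp
  \<comment> \<open>The same quotient has two limits, and comparing them gives the formula.\<close>
  have "((\<lambda>s. T s / zeta_sum (2 * s)) \<longlongrightarrow> T 1 / (pi\<^sup>2 / 6)) (at_right 1)"
    unfolding T_def
    by (intro tendsto_divide tendsto_euler_weight_sum(2) tendsto_zeta_sum_2) (auto simp: S_def)
  moreover have "((\<lambda>s. T s / zeta_sum (2 * s)) \<longlongrightarrow> A k) (at_right 1)"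
  proof -
    have "eventually (\<lambda>s. norm (T s / zeta_sum (2 * s) - A k) \<le> (K + W) / zeta_sum s) (at_right 1)"
    proof -
      have "eventually (\<lambda>s. s < 2) (at_right (1::real))"
        by (rule order_tendstoD[OF tendsto_ident_at]) auto
      moreover have "eventually (\<lambda>s. zeta_sum (2 * s) > 0) (at_right 1)"
        using tendsto_zeta_sum_2 pi by (rule order_tendstoD)
      moreover have "eventually (\<lambda>s. zeta_sum s > 0) (at_right 1)"
        using zeta_sum_at_top by (auto simp: filterlim_at_top_dense)
      ultimately show ?thesis using eventually_at_right_less[of 1]
      proof eventually_elim
        case (elim s)
        have "\<bar>A k * zeta_sum s - squarefree_sum s * T s\<bar> \<le> K + W"
          using K[of s] exponent_count_series_approx[of s k] elim
          unfolding T_def S_def W_def by linarith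
        also have "squarefree_sum s = zeta_sum s / zeta_sum (2 * s)"
          using squarefree_sum_mult_zeta_sum[of s] elim by (simp add: field_simps)
        also have "A k * zeta_sum s - zeta_sum s / zeta_sum (2 * s) * T s =
                     zeta_sum s * (A k - T s / zeta_sum (2 * s))"
          by (simp add: algebra_simps)
        finally have "zeta_sum s * \<bar>A k - T s / zeta_sum (2 * s)\<bar> \<le> K + W"
          using elim by (simp add: abs_mult)
        thus ?case
          using elim by (subst norm_minus_commute) (simp add: pos_le_divide_eq mult.commute)
      qed
    qed
    moreover have "((\<lambda>s. (K + W) / zeta_sum s) \<longlongrightarrow> 0) (at_right 1)"
      by (rule real_tendsto_divide_at_top[OF tendsto_const zeta_sum_at_top])
    ultimately have "((\<lambda>s. T s / zeta_sum (2 * s) - A k) \<longlongrightarrow> 0) (at_right 1)"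
      by (rule Lim_null_comparison)
    thus ?thesis by (simp add: LIM_zero_iff)
  qed
  ultimately have Ak: "A k = T 1 / (pi\<^sup>2 / 6)"
    by (intro tendsto_unique) auto
  have "S = {Q. Q > 0 \<and> num_exponents Q = k - 1}"
    using assms(2) by (auto simp: S_def)
  moreover have "(euler_weight 1 has_sum T 1) S"
    unfolding T_def by (intro has_sum_infsum tendsto_euler_weight_sum(1)) (auto simp: S_def)
  ultimately have "((\<lambda>n. rho k n / dedekind_psi n) has_sum T 1) {0<..}"
    using has_sum_rho_div_psi[of "k - 1" "T 1"] assms(2) by simp
  also have "?this \<longleftrightarrow> ((\<lambda>n. rho k (Suc n) / dedekind_psi (Suc n)) has_sum T 1) UNIV"
    by (rule has_sum_reindex_bij_witness[of _ Suc "\<lambda>n. n - 1"]) auto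
  finally have "(\<lambda>n. rho k (Suc n) / dedekind_psi (Suc n)) sums T 1"
    by (rule has_sum_imp_sums)
  thus ?thesis using Ak by (simp add: sums_iff)
qed

end
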